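(* Let $(M,d)$ be a compact metric space and $f\colon M\to M$ a homeomorphism such that $f$ and $f^{-1}$ are Lipschitz, and suppose that $f$ has a bracket $[\cdot,\cdot]\colon\Delta_\gamma\to M$ with $(c,\lambda)$-hyperbolic contraction, for some $\gamma>0$, $c\ge1$, $\lambda\in(0,1)$. Then the pseudo-orbit map $\mathrm{Sh}_f\colon\tilde M(f,\delta)\to M$ induced by this bracket has self-tuning.
   Context: $\tilde M=M^{\mathbb Z}$; $\sigma\colon\tilde M\to\tilde M$ is the shift, $(\sigma(x))_i=x_{i+1}$; $(\mathrm{orb}_f(p))_i=f^i(p)$. Fix $\mu\in(0,1)$ and let $\tilde d_s(x,y)=\sum_{i\in\mathbb Z}\mu^{|i|}d(x_i,y_i)$, a metric inducing the product topology on $\tilde M$. For $\delta\ge0$, $\tilde M(f,\delta)=\{x\in\tilde M: d(x_{i+1},f(x_i))\le\delta\ \forall i\in\mathbb Z\}$. $\Delta_\gamma=\{(p,q)\in M^2:d(p,q)\le\gamma\}$. A pseudo-orbit map is a continuous map $\mathrm{Sh}_f\colon\tilde M(f,\delta)\to M$ with $\mathrm{Sh}_f(\mathrm{orb}_f(p))=p$ for all $p\in M$. It has self-tuning if for all $\epsilon>0$ there is $\eta>0$ such that if $\tilde d_s(\sigma^i(x),\mathrm{orb}_f(x_i))<\eta$ for some $x\in\tilde M(f,\delta)$ and some $i\in\mathbb Z$, then $d(f^i(\mathrm{Sh}_f(x)),\mathrm{Sh}_f(\sigma^i(x)))\le\epsilon$. A bracket on $\Delta_\gamma$ is a continuous map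 $[\cdot,\cdot]\colon\Delta_\gamma\to M$ with $[p,p]=p$ for all $p$. It has $(c,\lambda)$-hyperbolic contraction if $d(p,q)\le\gamma$ implies $d(f^n([p,q]),f^n(q))\le c\lambda^n d(p,q)$ and $d(f^{-n}([p,q]),f^{-n}(p))\le c\lambda^n d(p,q)$ for all $n\ge0$. Induced pseudo-orbit map: let $L$ be a common Lipschitz constant of $f$ and $f^{-1}$, fix $m\ge1$ with $c\lambda^m\le\frac1{2c}$, put $L_m=1+L+\dots+L^{m-1}$, and take $\delta>0$ with $2\delta L_m\le\gamma$ and small enough that all brackets below are defined (this holds for every sufficiently small $\delta>0$). For $x\in\tilde M(f,\delta)$ define $q_0=x_0$, $q_n=[f^m(q_{n-1}),x_{nm}]$ for $n\ge1$, $p_n=f^{-nm}(q_n)$, and $\mathrm{Sh}_f^+(x)=\lim_{n\to\infty}p_n$ (the limit exists). Let $\mathrm{Sh}_f^-(x)$ be the point obtained by the same procedure with $f^{-1}$ in place of $f$ (applied to the reversed sequence $i\mapsto x_{-i}$ and the bracket $(p,q)\mapsto[q,p]$, which has hyperbolic contraction for $f^{-1}$): $q_0^-=x_0$, $q_n^-=[x_{-nm},f^{-m}(q_{n-1}^-)]$ for $n\ge 1$, and $\mathrm{Sh}_f^-(x)=\lim_{n\to\infty}f^{nm}(q^-_n)$. The induced pseudo-orbit map is $\mathrm{Sh}_f(x)=[\mathrm{Sh}_f^-(x),\mathrm{Sh}_f^+(x)]$; it is a pseudo-orbit map. *)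

theory Defs
  imports "HOL-Analysis.Analysis"
begin

text \<open>
  The compact metric space \<open>M\<close> is a type of class \<^class>\<open>metric_space\<close>; compactness of \<^term>\<open>UNIV\<close>
  is a hypothesis of the theorem. Sequences in \<open>M\<close> indexed by the integers are functions
  \<open>int \<Rightarrow> 'a\<close>, whose topology in the library is the product topology. Maps defined only on a
  subset (the bracket, the pseudo-orbit map) are total functions about which only the values on
  that subset are used.
\<close>

text \<open>Integer iterates; meant for bijective \<open>f\<close>, since negative iterates use \<^term>\<open>inv f\<close>.\<close>
definition int_iter :: "('a \<Rightarrow> 'a) \<Rightarrow> int \<Rightarrow> 'a \<Rightarrow> 'a" where
  "int_iter f i = (if 0 \<le> i then f ^^ nat i else inv f ^^ nat (- i))"

definition shift :: "(int \<Rightarrow> 'a) \<Rightarrow> int \<Rightarrow> 'a" where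
  "shift x = (\<lambda>i. x (i + 1))"

definition orb :: "('a \<Rightarrow> 'a) \<Rightarrow> 'a \<Rightarrow> int \<Rightarrow> 'a" where
  "orb f p = (\<lambda>i. int_iter f i p)"

definition seq_dist :: "real \<Rightarrow> (int \<Rightarrow> 'a::metric_space) \<Rightarrow> (int \<Rightarrow> 'a) \<Rightarrow> real" where
  "seq_dist \<mu> x y = (\<Sum>\<^sub>\<infinity>i. \<mu> ^ nat \<bar>i\<bar> * dist (x i) (y i))"

definition pseudo_orbits :: "('a::metric_space \<Rightarrow> 'a) \<Rightarrow> real \<Rightarrow> (int \<Rightarrow> 'a) set" where
  "pseudo_orbits f \<delta> = {x. \<forall>i. dist (x (i + 1)) (f (x i)) \<le> \<delta>}"

definition near_diag :: "real \<Rightarrow> ('a::metric_space \<times> 'a) set" where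
  "near_diag \<gamma> = {(p, q). dist p q \<le> \<gamma>}"

definition pseudo_orbit_map ::
  "('a::metric_space \<Rightarrow> 'a) \<Rightarrow> real \<Rightarrow> ((int \<Rightarrow> 'a) \<Rightarrow> 'a) \<Rightarrow> bool" where
  "pseudo_orbit_map f \<delta> Sh \<longleftrightarrow>
     continuous_on (pseudo_orbits f \<delta>) Sh \<and> (\<forall>p. Sh (orb f p) = p)"

definition self_tuning ::
  "real \<Rightarrow> ('a::metric_space \<Rightarrow> 'a) \<Rightarrow> real \<Rightarrow> ((int \<Rightarrow> 'a) \<Rightarrow> 'a) \<Rightarrow> bool" where
  "self_tuning \<mu> f \<delta> Sh \<longleftrightarrow>
     (\<forall>\<epsilon>>0. \<exists>\<eta>>0. \<forall>x\<in>pseudo_orbits f \<delta>. \<forall>i.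
        seq_dist \<mu> (int_iter shift i x) (orb f (x i)) < \<eta> \<longrightarrow>
        dist (int_iter f i (Sh x)) (Sh (int_iter shift i x)) \<le> \<epsilon>)"

definition is_bracket :: "real \<Rightarrow> ('a::metric_space \<times> 'a \<Rightarrow> 'a) \<Rightarrow> bool" where
  "is_bracket \<gamma> br \<longleftrightarrow> continuous_on (near_diag \<gamma>) br \<and> (\<forall>p. br (p, p) = p)"

definition hyperbolic_contraction ::
  "('a::metric_space \<Rightarrow> 'a) \<Rightarrow> real \<Rightarrow> ('a \<times> 'a \<Rightarrow> 'a) \<Rightarrow> real \<Rightarrow> real \<Rightarrow> bool" where
  "hyperbolic_contraction f \<gamma> br c lam \<longleftrightarrow>
     (\<forall>p q. dist p q \<le> \<gamma> \<longrightarrow> (\<forall>n.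
        dist ((f ^^ n) (br (p, q))) ((f ^^ n) q) \<le> c * lam ^ n * dist p q \<and>
        dist ((inv f ^^ n) (br (p, q))) ((inv f ^^ n) p) \<le> c * lam ^ n * dist p q))"

text \<open>The points \<open>q\<^sub>n\<close>.\<close>
primrec shadow_pt ::
  "('a \<Rightarrow> 'a) \<Rightarrow> ('a \<times> 'a \<Rightarrow> 'a) \<Rightarrow> nat \<Rightarrow> (int \<Rightarrow> 'a) \<Rightarrow> nat \<Rightarrow> 'a" where
  "shadow_pt f br m x 0 = x 0"
| "shadow_pt f br m x (Suc n) = br ((f ^^ m) (shadow_pt f br m x n), x (int (Suc n * m)))"

definition Sh_plus ::
  "('a::metric_space \<Rightarrow> 'a) \<Rightarrow> ('a \<times> 'a \<Rightarrow> 'a) \<Rightarrow> nat \<Rightarrow> (int \<Rightarrow> 'a) \<Rightarrow> 'a" where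
  "Sh_plus f br m x = lim (\<lambda>n. (inv f ^^ (n * m)) (shadow_pt f br m x n))"

text \<open>
  The points \<open>q\<^sub>n\<close> of the procedure for \<^term>\<open>inv f\<close>, with reversed sequence and swapped
  bracket: \<open>q\<^sub>0 = x 0\<close> and \<open>q\<^sub>n = br (x (- n m), (inv f ^^ m) q\<^sub>n\<^sub>-\<^sub>1)\<close>.
\<close>
definition shadow_pt_minus ::
  "('a \<Rightarrow> 'a) \<Rightarrow> ('a \<times> 'a \<Rightarrow> 'a) \<Rightarrow> nat \<Rightarrow> (int \<Rightarrow> 'a) \<Rightarrow> nat \<Rightarrow> 'a" where
  "shadow_pt_minus f br m x = shadow_pt (inv f) (br \<circ> prod.swap) m (\<lambda>i. x (- i))"

definition Sh_minus ::
  "('a::metric_space \<Rightarrow> 'a) \<Rightarrow> ('a \<times> 'a \<Rightarrow> 'a) \<Rightarrow> nat \<Rightarrow> (int \<Rightarrow> 'a) \<Rightarrow> 'a" where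
  "Sh_minus f br m x = lim (\<lambda>n. (f ^^ (n * m)) (shadow_pt_minus f br m x n))"

definition induced_map ::
  "('a::metric_space \<Rightarrow> 'a) \<Rightarrow> ('a \<times> 'a \<Rightarrow> 'a) \<Rightarrow> nat \<Rightarrow> (int \<Rightarrow> 'a) \<Rightarrow> 'a" where
  "induced_map f br m x = br (Sh_minus f br m x, Sh_plus f br m x)"

text \<open>
  All brackets occurring in the construction of \<^const>\<open>induced_map\<close> on the
  \<open>\<delta>\<close>-pseudo-orbits have their argument in the domain of the bracket.
\<close>
definition brackets_defined ::
  "('a::metric_space \<Rightarrow> 'a) \<Rightarrow> real \<Rightarrow> ('a \<times> 'a \<Rightarrow> 'a) \<Rightarrow> nat \<Rightarrow> real \<Rightarrow> bool" where
  "brackets_defined f \<gamma> br m \<delta> \<longleftrightarrow>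
     (\<forall>x\<in>pseudo_orbits f \<delta>.
        (\<forall>n. ((f ^^ m) (shadow_pt f br m x n), x (int (Suc n * m))) \<in> near_diag \<gamma>) \<and>
        (\<forall>n. (x (- int (Suc n * m)), (inv f ^^ m) (shadow_pt_minus f br m x n)) \<in> near_diag \<gamma>) \<and>
        (Sh_minus f br m x, Sh_plus f br m x) \<in> near_diag \<gamma>)"

end

theory Submission imports Defs begin

text \<open>
  Write \<open>Sh\<close> for the induced map. It is the identity on orbits because brackets of equal points are
  trivial. It is continuous because \<open>p\<^sub>n\<close> moves by at most \<open>\<gamma> / 2\<^sup>n\<^sup>+\<^sup>1\<close> from step \<open>n\<close> to step \<open>n + 1\<close>,
  so that the forward limit is a uniform limit of maps depending continuously on finitely many
  coordinates. The backward limit is the forward limit for \<open>inv f\<close>, the swapped bracket and the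
  reversed sequence, so everything is proved for the forward limit only and then transferred.

  For self-tuning, a small value of \<open>seq_dist\<close> says that \<open>x\<close> follows the true orbit of \<open>x i\<close> within
  \<open>\<rho>\<close> on a window of radius \<open>J\<close> around time \<open>i\<close> (\<open>near_orbit\<close>), where \<open>J\<close> and \<open>\<rho>\<close> may be prescribed
  independently of \<open>x\<close> and \<open>i\<close>. Both \<open>f\<^sup>i (Sh x)\<close> and \<open>Sh (\<sigma>\<^sup>i x)\<close> are then close to \<open>x i\<close>:

  \<^item> For every fixed \<open>i\<close>, hence uniformly for \<open>i\<close> in a finite set, \<open>f\<^sup>i (Sh x)\<close> is close to \<open>x i\<close> since
    \<open>Sh\<close> is uniformly continuous on the compact space of pseudo-orbits and is the identity on
    orbits (\<open>fixed_time_shadows_near_orbits\<close>). The case \<open>i = 0\<close> applied to \<open>\<sigma>\<^sup>i x\<close> shows that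
    \<open>Sh (\<sigma>\<^sup>i x)\<close> is close to \<open>x i\<close> for all \<open>i\<close>.

  \<^item> For large \<open>i\<close>, the forward contraction of the bracket lets \<open>f\<^sup>i\<close> take \<open>Sh x\<close> close to
    \<open>f\<^sup>i (Sh_plus x)\<close>. The latter is close to \<open>x i\<close> because its distance to \<open>x i\<close> is controlled by the
    errors of the pseudo-orbit with weights decaying exponentially away from time \<open>i\<close>, and these
    errors are small on the window (\<open>Sh_plus_shadows_blocks\<close>). Very negative \<open>i\<close> are the same
    statement for \<open>inv f\<close>.
\<close>

section \<open>Integer iterates of a bijection\<close>

lemma int_iter_of_nat [simp]: "int_iter f (int n) = f ^^ n"
  by (simp add: int_iter_def)

lemma int_iter_0 [simp]: "int_iter f 0 = id"
  by (simp add: int_iter_def)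

lemma int_iter_minus_of_nat [simp]: "int_iter f (- int n) = inv f ^^ n"
  by (simp add: int_iter_def)

lemma int_iter_inv:
  assumes "bij f"
  shows "int_iter (inv f) i = int_iter f (- i)"
  by (cases i rule: int_cases2) (simp_all add: inv_inv_eq[OF assms])

lemma int_iter_plus1:
  assumes "bij f"
  shows "int_iter f (i + 1) p = f (int_iter f i p)"
proof (cases i)
  case (nonneg n)
  then have "i + 1 = int (Suc n)" by simp
  then show ?thesis using nonneg by (simp only: int_iter_of_nat) simp
next
  case (neg n)
  have "i + 1 = - int n" using neg by simp
  then show ?thesis using neg
    by (simp only: int_iter_minus_of_nat) (simp add: surj_f_inv_f[OF bij_is_surj[OF assms]])
qed

lemma int_iter_minus1:
  assumes "bij f"
  shows "int_iter f (i - 1) p = inv f (int_iter f i p)"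
  using int_iter_plus1[OF assms, of "i - 1" p]
  by (simp add: inv_f_f[OF bij_is_inj[OF assms]])

lemma int_iter_add:
  assumes "bij f"
  shows "int_iter f (i + j) p = int_iter f i (int_iter f j p)"
proof (induction i rule: int_induct[of _ 0])
  case base
  show ?case by simp
next
  case (step1 i)
  have "int_iter f (i + 1 + j) p = int_iter f ((i + j) + 1) p" by (simp add: ac_simps)
  then show ?case using step1 by (simp only: int_iter_plus1[OF assms])
next
  case (step2 i)
  have "int_iter f (i - 1 + j) p = int_iter f ((i + j) - 1) p" by (simp add: algebra_simps)
  then show ?case using step2 by (simp only: int_iter_minus1[OF assms])
qed

lemma bij_shift: "bij (shift :: (int \<Rightarrow> 'a) \<Rightarrow> int \<Rightarrow> 'a)"
  by (rule o_bij[where g = "\<lambda>x i. x (i - 1)"]) (auto simp: shift_def fun_eq_iff)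

lemma int_iter_shift: "int_iter shift i x = (\<lambda>j. x (i + j))"
proof (induction i rule: int_induct[of _ 0])
  case base
  show ?case by simp
next
  case (step1 i)
  then show ?case by (simp only: int_iter_plus1[OF bij_shift]) (simp add: shift_def ac_simps)
next
  case (step2 i)
  have "inv shift = (\<lambda>(x :: int \<Rightarrow> 'a) i. x (i - 1))"
    by (rule inv_equality) (auto simp: shift_def)
  with step2 show ?case
    by (simp only: int_iter_minus1[OF bij_shift]) (simp add: algebra_simps)
qed

lemma dist_funpow_lipschitz:
  fixes f :: "'a::metric_space \<Rightarrow> 'a"
  assumes "L-lipschitz_on UNIV f"
  shows "dist ((f ^^ n) a) ((f ^^ n) b) \<le> L ^ n * dist a b"
proof (induction n)
  case (Suc n)
  have "dist ((f ^^ Suc n) a) ((f ^^ Suc n) b) \<le> L * dist ((f ^^ n) a) ((f ^^ n) b)"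
    using lipschitz_onD[OF assms] by simp
  also have "\<dots> \<le> L * (L ^ n * dist a b)"
    using Suc lipschitz_on_nonneg[OF assms] by (rule mult_left_mono)
  finally show ?case by (simp add: mult.assoc)
qed simp

section \<open>Sums with geometric weights\<close>

text \<open>The weights \<open>1 / 2\<^sup>l\<^sup>+\<^sup>1\<close> sum up to less than \<open>1\<close>.\<close>
lemma dist_le_of_geometric_steps:
  fixes z :: "nat \<Rightarrow> 'a::metric_space"
  assumes "\<And>l. l < N \<Longrightarrow> dist (z (Suc l)) (z l) \<le> B / 2 ^ Suc l" and "0 \<le> B"
  shows "dist (z N) (z 0) \<le> B"
proof -
  have "n \<le> N \<Longrightarrow> dist (z n) (z 0) \<le> B * (1 - 1 / 2 ^ n)" for n
  proof (induction n)
    case (Suc n)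
    have "dist (z (Suc n)) (z 0) \<le> dist (z (Suc n)) (z n) + dist (z n) (z 0)"
      by (rule dist_triangle)
    also have "\<dots> \<le> B / 2 ^ Suc n + B * (1 - 1 / 2 ^ n)"
      using Suc assms(1)[of n] by (intro add_mono) auto
    also have "\<dots> = B * (1 - 1 / 2 ^ Suc n)" by (simp add: field_simps)
    finally show ?case .
  qed simp
  from this[of N] have "dist (z N) (z 0) \<le> B * (1 - 1 / 2 ^ N)" by simp
  also have "\<dots> \<le> B * 1" using assms(2) by (intro mult_left_mono) auto
  finally show ?thesis by simp
qed

text \<open>
  The affine map \<open>t \<mapsto> t / 2 + e\<close> halves the distance to its fixed point \<open>2 * e\<close>. The recursion is
  assumed only up to \<open>N\<close>, since errors will be controlled only inside a window.
\<close>
lemma geometric_decay_with_error: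
  fixes D :: "nat \<Rightarrow> real"
  assumes "D 0 \<le> G" and "\<And>j. j < N \<Longrightarrow> D (Suc j) \<le> D j / 2 + e" and "0 \<le> e" and "j \<le> N"
  shows "D j \<le> G / 2 ^ j + 2 * e"
  using assms(4)
proof (induction j)
  case 0
  then show ?case using assms by simp
next
  case (Suc j)
  have "D (Suc j) \<le> D j / 2 + e" using Suc assms(2) by simp
  also have "\<dots> \<le> (G / 2 ^ j + 2 * e) / 2 + e" using Suc by simp
  also have "\<dots> = G / 2 ^ Suc j + 2 * e" by (simp add: field_simps)
  finally show ?case .
qed

section \<open>Near orbits\<close>

definition near_orbit ::
  "('a::metric_space \<Rightarrow> 'a) \<Rightarrow> nat \<Rightarrow> real \<Rightarrow> (int \<Rightarrow> 'a) \<Rightarrow> int \<Rightarrow> bool" where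
  "near_orbit f J \<rho> x i \<longleftrightarrow>
     (\<forall>j. \<bar>j\<bar> \<le> int J \<longrightarrow> dist (x (i + j)) (int_iter f j (x i)) \<le> \<rho>)"

lemma near_orbit_reverse:
  assumes "bij f"
  shows "near_orbit (inv f) J \<rho> (\<lambda>i. x (- i)) (- i) \<longleftrightarrow> near_orbit f J \<rho> x i"
proof
  assume *: "near_orbit (inv f) J \<rho> (\<lambda>i. x (- i)) (- i)"
  show "near_orbit f J \<rho> x i"
    unfolding near_orbit_def
  proof (intro allI impI)
    fix j :: int assume "\<bar>j\<bar> \<le> int J"
    then show "dist (x (i + j)) (int_iter f j (x i)) \<le> \<rho>"
      using *[unfolded near_orbit_def, rule_format, of "- j"] by (simp add: int_iter_inv[OF assms] add.commute)
  qed
next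
  assume *: "near_orbit f J \<rho> x i"
  show "near_orbit (inv f) J \<rho> (\<lambda>i. x (- i)) (- i)"
    unfolding near_orbit_def
  proof (intro allI impI)
    fix j :: int assume "\<bar>j\<bar> \<le> int J"
    then show "dist (x (- (- i + j))) (int_iter (inv f) j (x (- (- i)))) \<le> \<rho>"
      using *[unfolded near_orbit_def, rule_format, of "- j"] by (simp add: int_iter_inv[OF assms])
  qed
qed

lemma summable_on_geometric_int:
  fixes \<mu> :: real
  assumes "0 < \<mu>" and "\<mu> < 1"
  shows "(\<lambda>i. \<mu> ^ nat \<bar>i\<bar>) summable_on UNIV"
proof -
  have geo: "(\<lambda>n. \<mu> ^ n) summable_on UNIV"
    using assms by (intro norm_summable_imp_summable_on) (simp add: norm_power)
  have "(\<lambda>i. \<mu> ^ nat \<bar>i\<bar>) summable_on range int"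
    by (subst summable_on_reindex) (use geo in \<open>auto simp: o_def inj_on_def\<close>)
  moreover have "(\<lambda>i. \<mu> ^ nat \<bar>i\<bar>) summable_on range (\<lambda>n. - int n)"
    by (subst summable_on_reindex) (use geo in \<open>auto simp: o_def inj_on_def\<close>)
  ultimately have "(\<lambda>i. \<mu> ^ nat \<bar>i\<bar>) summable_on (range int \<union> range (\<lambda>n. - int n))"
    by (rule summable_on_union)
  moreover have "range int \<union> range (\<lambda>n. - int n) = UNIV"
    by (auto intro: int_cases2)
  ultimately show ?thesis by simp
qed

lemma dist_coordinate_le_seq_dist:
  fixes x y :: "int \<Rightarrow> 'a::metric_space"
  assumes "bounded (UNIV :: 'a set)" and "0 < \<mu>" and "\<mu> < 1"
  shows "\<mu> ^ nat \<bar>j\<bar> * dist (x j) (y j) \<le> seq_dist \<mu> x y"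
proof -
  obtain B where B: "\<And>p q :: 'a. dist p q \<le> B"
    using assms(1) unfolding bounded_two_points by auto
  have "(\<lambda>i. \<mu> ^ nat \<bar>i\<bar> * B) summable_on UNIV"
    by (intro summable_on_cmult_left summable_on_geometric_int assms)
  then have "(\<lambda>i. \<mu> ^ nat \<bar>i\<bar> * dist (x i) (y i)) summable_on UNIV"
    by (rule summable_on_comparison_test) (use assms B in \<open>auto intro!: mult_left_mono\<close>)
  from finite_sum_le_infsum[OF this, of "{j}"] assms show ?thesis
    by (simp add: seq_dist_def)
qed

text \<open>
  Inside the window every coordinate carries weight at least \<open>\<mu>\<^sup>J\<close> in \<open>seq_dist\<close>. Boundedness makes
  the sum defining \<open>seq_dist\<close> converge; otherwise it would be \<open>0\<close> by convention.
\<close>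
lemma near_orbit_if_seq_dist_small:
  fixes f :: "'a::metric_space \<Rightarrow> 'a"
  assumes "bounded (UNIV :: 'a set)" and \<mu>: "0 < \<mu>" "\<mu> < 1" and "0 < \<rho>"
    and small: "seq_dist \<mu> (int_iter shift i x) (orb f (x i)) < \<mu> ^ J * \<rho>"
  shows "near_orbit f J \<rho> x i"
  unfolding near_orbit_def
proof (intro allI impI)
  fix j :: int assume j: "\<bar>j\<bar> \<le> int J"
  let ?d = "dist (x (i + j)) (int_iter f j (x i))"
  have "\<mu> ^ J * ?d \<le> \<mu> ^ nat \<bar>j\<bar> * ?d"
    using \<mu> j by (intro mult_right_mono power_decreasing) auto
  also have "\<dots> \<le> seq_dist \<mu> (int_iter shift i x) (orb f (x i))"
    using dist_coordinate_le_seq_dist[OF assms(1) \<mu>, of j "int_iter shift i x" "orb f (x i)"]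
    by (simp add: int_iter_shift orb_def)
  finally have "\<mu> ^ J * ?d < \<mu> ^ J * \<rho>" using small by simp
  then show "?d \<le> \<rho>" using \<mu> by simp
qed

text \<open>
  Uniform continuity in terms of coordinates: in the library metric on \<open>int \<Rightarrow> 'a\<close>, which enumerates
  the index set by \<open>from_nat\<close>, two sequences are close as soon as they are close on a finite window.
\<close>
lemma continuous_uniform_on_window:
  fixes F :: "(int \<Rightarrow> 'a::metric_space) \<Rightarrow> 'b::metric_space"
  assumes "compact S" and "continuous_on S F" and "0 < \<epsilon>"
  obtains J \<rho> where "0 < \<rho>"
    and "\<And>x y. x \<in> S \<Longrightarrow> y \<in> S \<Longrightarrow> (\<And>j. \<bar>j\<bar> \<le> int J \<Longrightarrow> dist (x j) (y j) \<le> \<rho>) \<Longrightarrow>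
           dist (F x) (F y) < \<epsilon>"
proof -
  obtain d where d: "0 < d" "\<And>x y. x \<in> S \<Longrightarrow> y \<in> S \<Longrightarrow> dist x y < d \<Longrightarrow> dist (F x) (F y) < \<epsilon>"
    using compact_uniformly_continuous[OF assms(2,1)] assms(3)
    unfolding uniformly_continuous_on_def by (metis dist_commute)
  obtain N :: nat where N: "(1 / 2) ^ N < d / 2"
    using real_arch_pow_inv[of "d / 2" "1 / 2"] d by auto
  \<comment> \<open>the window of radius \<open>J\<close> contains the first \<open>N + 1\<close> indices of the enumeration\<close>
  define J where "J = nat (Max ((\<lambda>n. \<bar>from_nat n :: int\<bar>) ` {..N}))"
  show thesis
  proof (rule that[of "d / 4" J])
    show "0 < d / 4" using d by simp
    fix x y assume xy: "x \<in> S" "y \<in> S" and close: "\<And>j. \<bar>j\<bar> \<le> int J \<Longrightarrow> dist (x j) (y j) \<le> d / 4"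
    have "dist (x (from_nat n)) (y (from_nat n)) \<le> d / 4" if "n \<le> N" for n
    proof (rule close)
      have "\<bar>from_nat n :: int\<bar> \<le> Max ((\<lambda>n. \<bar>from_nat n :: int\<bar>) ` {..N})"
        using that by (intro Max_ge) auto
      then show "\<bar>from_nat n :: int\<bar> \<le> int J" unfolding J_def by linarith
    qed
    then have "Max {dist (x (from_nat n)) (y (from_nat n)) |n. n \<le> N} \<le> d / 4"
      by (subst Max_le_iff) auto
    with dist_fun_le_dist_first_terms[of x y N] N have "dist x y < d" by simp
    with d xy show "dist (F x) (F y) < \<epsilon>" by blast
  qed
qed

lemma compact_pseudo_orbits:
  fixes f :: "'a::metric_space \<Rightarrow> 'a"
  assumes "compact (UNIV :: 'a set)" and "continuous_on UNIV f"
  shows "compact (pseudo_orbits f \<delta>)"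
proof -
  have "compact_space (product_topology (\<lambda>i::int. euclidean :: 'a topology) UNIV)"
    unfolding compact_space_product_topology using assms(1) by (simp add: compact_space_def)
  then have "compact (UNIV :: (int \<Rightarrow> 'a) set)"
    by (simp add: euclidean_product_topology compact_space_def)
  moreover have "closed (pseudo_orbits f \<delta>)"
  proof -
    have "pseudo_orbits f \<delta> = (\<Inter>i. {x. dist (x (i + 1)) (f (x i)) \<le> \<delta>})"
      by (auto simp: pseudo_orbits_def)
    moreover have "closed {x. dist (x (i + 1)) (f (x i)) \<le> \<delta>}" for i
      by (intro closed_Collect_le continuous_intros continuous_on_compose2[OF assms(2)]) auto
    ultimately show ?thesis by auto
  qed
  ultimately show ?thesis using closed_Int_compact[of "pseudo_orbits f \<delta>" UNIV] by simp
qed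

lemma orb_in_pseudo_orbits:
  assumes "bij f" and "0 \<le> \<delta>"
  shows "orb f p \<in> pseudo_orbits f \<delta>"
  using assms by (simp add: pseudo_orbits_def orb_def int_iter_plus1)

lemma shift_in_pseudo_orbits:
  "x \<in> pseudo_orbits f \<delta> \<Longrightarrow> int_iter shift i x \<in> pseudo_orbits f \<delta>"
  unfolding pseudo_orbits_def by (simp add: int_iter_shift) (metis add.assoc)

section \<open>The forward limit of an induced pseudo-orbit map\<close>

text \<open>
  The conditions are invariant under reversing time (\<open>reversed\<close> below), which is why \<open>f\<close> and \<open>inv f\<close>
  share the Lipschitz constant. Assuming \<open>1 \<le> L\<close> makes \<open>L ^ r\<close> monotone in \<open>r\<close>.
\<close>
locale hyperbolic_bracket =
  fixes f :: "'a::metric_space \<Rightarrow> 'a" and \<gamma> :: real and br :: "'a \<times> 'a \<Rightarrow> 'a"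
    and c lam L :: real and m :: nat
  assumes compact_space: "compact (UNIV :: 'a set)"
    and bij: "bij f"
    and lip: "L-lipschitz_on UNIV f" and lip_inv: "L-lipschitz_on UNIV (inv f)"
    and L_ge_1: "1 \<le> L"
    and \<gamma>_pos: "0 < \<gamma>" and c_ge_1: "1 \<le> c" and lam_pos: "0 < lam" and lam_less_1: "lam < 1"
    and bracket: "is_bracket \<gamma> br"
    and contraction: "hyperbolic_contraction f \<gamma> br c lam"
    and m_pos: "1 \<le> m" and m_large: "c * lam ^ m \<le> 1 / (2 * c)"
begin

lemma reversed: "hyperbolic_bracket (inv f) \<gamma> (br \<circ> prod.swap) c lam L m"
proof
  show "is_bracket \<gamma> (br \<circ> prod.swap)"
  proof -
    have "continuous_on (near_diag \<gamma>) (\<lambda>z. br (prod.swap z))"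
    proof (rule continuous_on_compose2[of "near_diag \<gamma>" br])
      show "continuous_on (near_diag \<gamma>) br" using bracket by (simp add: is_bracket_def)
      show "continuous_on (near_diag \<gamma>) (prod.swap :: 'a \<times> 'a \<Rightarrow> _)"
        by (rule continuous_on_swap)
    qed (auto simp: near_diag_def dist_commute)
    then show ?thesis using bracket by (simp add: is_bracket_def o_def)
  qed
  show "hyperbolic_contraction (inv f) \<gamma> (br \<circ> prod.swap) c lam"
    using contraction unfolding hyperbolic_contraction_def inv_inv_eq[OF bij]
    by simp (metis dist_commute)
qed (use compact_space bij lip lip_inv L_ge_1 \<gamma>_pos c_ge_1 lam_pos lam_less_1 m_pos m_large
     in \<open>auto simp: inv_inv_eq bij_imp_bij_inv\<close>)

lemma continuous_f: "continuous_on UNIV f"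
  using lip by (rule lipschitz_on_continuous_on)

lemma continuous_funpow: "continuous_on UNIV (f ^^ n)"
proof (induction n)
  case (Suc n)
  then show ?case using continuous_on_compose2[OF continuous_f Suc] by (simp add: o_def)
qed (simp add: id_def)

lemma funpow_inv_cancel: "(inv f ^^ n) ((f ^^ n) p) = p"
  using inv_fn_o_fn_is_id[OF bij, of n] by (simp add: fun_eq_iff)

lemma funpow_cancel_inv: "(f ^^ n) ((inv f ^^ n) p) = p"
  using fn_o_inv_fn_is_id[OF bij, of n] by (simp add: fun_eq_iff)

lemma bracket_forward:
  "dist p q \<le> \<gamma> \<Longrightarrow> dist ((f ^^ n) (br (p, q))) ((f ^^ n) q) \<le> c * lam ^ n * dist p q"
  using contraction by (simp add: hyperbolic_contraction_def)

lemma bracket_backward: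
  "dist p q \<le> \<gamma> \<Longrightarrow> dist ((inv f ^^ n) (br (p, q))) ((inv f ^^ n) p) \<le> c * lam ^ n * dist p q"
  using contraction by (simp add: hyperbolic_contraction_def)

text \<open>
  As \<open>c \<ge> 1\<close>, the choice of \<open>m\<close> gives both \<open>c * lam ^ m \<le> 1 / 2\<close> and \<open>lam ^ m \<le> 1 / 2\<close>; the first
  estimate absorbs the constant \<open>c\<close> once.
\<close>
lemma contraction_rate: "c * lam ^ (Suc l * m) \<le> 1 / 2 ^ Suc l"
proof -
  have "1 / (2 * c) \<le> 1 / 2" using c_ge_1 by (simp add: field_simps)
  with m_large have half: "c * lam ^ m \<le> 1 / 2" by simp
  have "1 * lam ^ m \<le> c * lam ^ m" using c_ge_1 lam_pos by (intro mult_right_mono) auto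
  with half have "lam ^ m \<le> 1 / 2" by simp
  then have "(lam ^ m) ^ l \<le> (1 / 2) ^ l" using lam_pos by (intro power_mono) auto
  with half have "(c * lam ^ m) * (lam ^ m) ^ l \<le> (1 / 2) * (1 / 2) ^ l"
    using c_ge_1 lam_pos by (intro mult_mono) auto
  then show ?thesis
    by (simp add: power_add power_mult[symmetric] power_one_over mult.assoc mult.commute)
qed

abbreviation q :: "(int \<Rightarrow> 'a) \<Rightarrow> nat \<Rightarrow> 'a" where
  "q x n \<equiv> shadow_pt f br m x n"

abbreviation p :: "(int \<Rightarrow> 'a) \<Rightarrow> nat \<Rightarrow> 'a" where
  "p x n \<equiv> (inv f ^^ (n * m)) (q x n)"

definition gap :: "(int \<Rightarrow> 'a) \<Rightarrow> nat \<Rightarrow> real" where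
  "gap x n = dist ((f ^^ m) (q x n)) (x (int (Suc n * m)))"

text \<open>
  The forward construction for \<open>x\<close> uses the bracket only on its domain. Unlike the bound \<open>\<delta>\<close> on the
  jumps, this can be required of reversed sequences as well: a \<open>\<delta>\<close>-pseudo-orbit of \<open>f\<close> reverses only
  to an \<open>L * \<delta>\<close>-pseudo-orbit of \<open>inv f\<close>.
\<close>
definition chained :: "(int \<Rightarrow> 'a) \<Rightarrow> bool" where
  "chained x \<longleftrightarrow> (\<forall>n. gap x n \<le> \<gamma>)"

text \<open>
  Replacing \<open>q\<^sub>k\<close> by \<open>q\<^sub>k\<^sub>+\<^sub>1\<close> changes the past very little: \<open>q\<^sub>k\<^sub>+\<^sub>1\<close> is a bracket with first argument
  \<open>f\<^sup>m q\<^sub>k\<close>, and backward iterates contract the distance to the first argument. With \<open>l = k\<close> this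
  bounds the distance from \<open>p\<^sub>k\<close> to \<open>p\<^sub>k\<^sub>+\<^sub>1\<close>; a smaller \<open>l\<close> bounds the distance between their images at
  time \<open>(k - l) * m\<close>.
\<close>
lemma backward_step:
  assumes "chained x"
  shows "dist ((inv f ^^ (Suc l * m)) (q x (Suc k))) ((inv f ^^ (l * m)) (q x k))
           \<le> gap x k / 2 ^ Suc l"
proof -
  have "(inv f ^^ (Suc l * m)) ((f ^^ m) (q x k)) = (inv f ^^ (l * m)) (q x k)"
    by (simp add: add.commute[of m] funpow_add funpow_inv_cancel)
  moreover have "gap x k \<le> \<gamma>" using assms by (simp add: chained_def)
  ultimately have "dist ((inv f ^^ (Suc l * m)) (q x (Suc k))) ((inv f ^^ (l * m)) (q x k))
      \<le> c * lam ^ (Suc l * m) * gap x k"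
    using bracket_backward[of "(f ^^ m) (q x k)" "x (int (Suc k * m))" "Suc l * m"]
    by (simp add: gap_def)
  also have "\<dots> \<le> 1 / 2 ^ Suc l * gap x k"
    by (intro mult_right_mono contraction_rate) (simp add: gap_def)
  finally show ?thesis by simp
qed

lemma dist_p_le:
  assumes "chained x" and "n \<le> N"
  shows "dist (p x N) (p x n) \<le> \<gamma> / 2 ^ n"
proof -
  define z where "z l = p x (n + l)" for l
  have "dist (z (N - n)) (z 0) \<le> \<gamma> / 2 ^ n"
  proof (rule dist_le_of_geometric_steps)
    fix l
    have "dist (z (Suc l)) (z l) \<le> gap x (n + l) / 2 ^ Suc (n + l)"
      using backward_step[OF assms(1), of "n + l" "n + l"] by (simp add: z_def)
    also have "\<dots> \<le> \<gamma> / 2 ^ Suc (n + l)"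
      using assms(1) by (intro divide_right_mono) (auto simp: chained_def)
    finally show "dist (z (Suc l)) (z l) \<le> \<gamma> / 2 ^ n / 2 ^ Suc l"
      by (simp add: power_add)
  qed (use \<gamma>_pos in simp)
  then show ?thesis using assms(2) by (simp add: z_def)
qed

lemma p_tendsto_Sh_plus:
  assumes "chained x"
  shows "p x \<longlonglongrightarrow> Sh_plus f br m x"
proof -
  have "Cauchy (p x)"
    unfolding Cauchy_altdef2
  proof (intro allI impI)
    fix e :: real assume e: "0 < e"
    obtain n :: nat where "(1 / 2) ^ n < e / \<gamma>"
      using real_arch_pow_inv[of "e / \<gamma>" "1 / 2"] e \<gamma>_pos by auto
    then have "\<gamma> / 2 ^ n < e" using \<gamma>_pos by (simp add: field_simps power_one_over)
    then show "\<exists>n. \<forall>N\<ge>n. dist (p x N) (p x n) < e"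
      using dist_p_le[OF assms] by (meson order.strict_trans1)
  qed
  then have "convergent (p x)"
    using compact_imp_complete[OF compact_space] by (auto simp: complete_def convergent_def)
  then show ?thesis by (simp add: Sh_plus_def convergent_LIMSEQ_iff)
qed

lemma dist_p_Sh_plus_le:
  assumes "chained x"
  shows "dist (p x n) (Sh_plus f br m x) \<le> \<gamma> / 2 ^ n"
  by (rule Lim_dist_ubound[OF _ p_tendsto_Sh_plus[OF assms]])
     (use dist_p_le[OF assms, of n] in \<open>auto simp: dist_commute intro!: eventually_sequentiallyI[of n]\<close>)

lemma continuous_on_shadow_pt:
  assumes "\<And>x. x \<in> S \<Longrightarrow> chained x"
  shows "continuous_on S (\<lambda>x. q x n)"
proof (induction n)
  case 0
  show ?case by (auto intro!: continuous_intros continuous_on_subset[OF continuous_on_product_coordinates])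
next
  case (Suc n)
  have arg: "continuous_on S (\<lambda>x. ((f ^^ m) (q x n), x (int (Suc n * m))))"
    by (intro continuous_on_Pair continuous_on_compose2[OF continuous_funpow Suc]
          continuous_on_subset[OF continuous_on_product_coordinates]) auto
  have br: "continuous_on (near_diag \<gamma>) br" using bracket by (simp add: is_bracket_def)
  have "(\<lambda>x. ((f ^^ m) (q x n), x (int (Suc n * m)))) ` S \<subseteq> near_diag \<gamma>"
    using assms unfolding near_diag_def chained_def gap_def by auto
  then show ?case
    unfolding shadow_pt.simps by (rule continuous_on_compose2[OF br arg])
qed

lemma continuous_on_Sh_plus:
  assumes "\<And>x. x \<in> S \<Longrightarrow> chained x"
  shows "continuous_on S (Sh_plus f br m)"
proof (rule uniform_limit_theorem)
  interpret rev: hyperbolic_bracket "inv f" \<gamma> "br \<circ> prod.swap" c lam L m by (rule reversed)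
  show "\<forall>\<^sub>F n in sequentially. continuous_on S (\<lambda>x. p x n)"
    by (intro always_eventually allI
          continuous_on_compose2[OF rev.continuous_funpow continuous_on_shadow_pt] assms) auto
  show "uniform_limit S (\<lambda>n x. p x n) (Sh_plus f br m) sequentially"
  proof (rule uniform_limitI)
    fix e :: real assume e: "0 < e"
    have "(\<lambda>n. \<gamma> / 2 ^ n) \<longlonglongrightarrow> 0" by (rule LIMSEQ_divide_realpow_zero) simp
    then have "\<forall>\<^sub>F n in sequentially. \<gamma> / 2 ^ n < e" using e by (rule order_tendstoD)
    then show "\<forall>\<^sub>F n in sequentially. \<forall>x\<in>S. dist (p x n) (Sh_plus f br m x) < e"
      by eventually_elim (meson assms dist_p_Sh_plus_le order.strict_trans1)
  qed
qed simp

lemma Sh_plus_orb: "Sh_plus f br m (orb f a) = a"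
proof -
  have "q (orb f a) n = (f ^^ (n * m)) a" for n
  proof (induction n)
    case 0
    show ?case by (simp add: orb_def)
  next
    case (Suc n)
    have "(f ^^ m) (q (orb f a) n) = (f ^^ (Suc n * m)) a"
      using Suc by (simp add: funpow_add)
    moreover have "orb f a (int (Suc n * m)) = (f ^^ (Suc n * m)) a"
      unfolding orb_def by (simp only: int_iter_of_nat)
    ultimately show ?case using bracket by (simp add: is_bracket_def)
  qed
  then have "p (orb f a) = (\<lambda>n. a)" by (simp add: funpow_inv_cancel)
  then show ?thesis by (simp add: Sh_plus_def)
qed

section \<open>Shadowing a pseudo-orbit at late times\<close>

text \<open>
  \<open>q\<^sub>k\<^sub>+\<^sub>1\<close> is a bracket with second argument \<open>x ((k + 1) * m)\<close>, and forward iterates contract the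
  distance to the second argument. So the previous gap is halved, and only the error \<open>e\<close> of the
  pseudo-orbit over one block of length \<open>m\<close> is added.
\<close>
lemma gap_Suc_le:
  assumes "chained x"
    and "dist ((f ^^ m) (x (int (Suc k * m)))) (x (int (Suc (Suc k) * m))) \<le> e"
  shows "gap x (Suc k) \<le> gap x k / 2 + e"
proof -
  let ?y = "x (int (Suc k * m))"
  have "gap x (Suc k) \<le> dist ((f ^^ m) (q x (Suc k))) ((f ^^ m) ?y)
      + dist ((f ^^ m) ?y) (x (int (Suc (Suc k) * m)))"
    unfolding gap_def by (rule dist_triangle)
  also have "dist ((f ^^ m) (q x (Suc k))) ((f ^^ m) ?y) \<le> c * lam ^ m * gap x k"
    using assms(1) bracket_forward[of "(f ^^ m) (q x k)" ?y m]
    by (simp add: chained_def gap_def)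
  also have "\<dots> \<le> 1 / 2 * gap x k"
    using contraction_rate[of 0] by (intro mult_right_mono) (auto simp: gap_def)
  finally show ?thesis using assms(2) by simp
qed

text \<open>
  The gaps start from at most \<open>\<gamma>\<close> when the window opens at block \<open>n - W\<close>; by block \<open>n\<close> they have
  dropped to \<open>B = \<gamma> / 2 ^ W + 2 * e\<close> and stay there up to the end of the window. Hence \<open>q\<^sub>n\<close> is within
  \<open>c * B\<close> of \<open>x (n * m)\<close>. Seen from time \<open>n * m\<close>, the later steps of the construction move \<open>q\<^sub>n\<close> by at
  most \<open>B\<close> inside the window, and by at most \<open>\<gamma> / 2 ^ W\<close> beyond it, where only \<open>chained\<close> bounds the gaps.
\<close>
lemma Sh_plus_shadows_blocks:
  assumes "chained x" and "W < n" and "0 \<le> e"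
    and err: "\<And>k. n \<le> k + W \<Longrightarrow> k < n + W \<Longrightarrow>
                dist ((f ^^ m) (x (int (k * m)))) (x (int (Suc k * m))) \<le> e"
  shows "dist ((f ^^ (n * m)) (Sh_plus f br m x)) (x (int (n * m)))
           \<le> (c + 1) * (\<gamma> / 2 ^ W + 2 * e) + \<gamma> / 2 ^ W"
proof -
  define a where "a = n - Suc W"
  have n: "n = Suc (a + W)" using assms(2) by (simp add: a_def)
  define B where "B = \<gamma> / 2 ^ W + 2 * e"
  have B: "0 \<le> B" using \<gamma>_pos assms(3) by (simp add: B_def)
  have gap_le: "gap x (a + j) \<le> B" if "W \<le> j" "j \<le> 2 * W" for j
  proof -
    have "gap x (a + j) \<le> \<gamma> / 2 ^ j + 2 * e"
    proof (rule geometric_decay_with_error[where D = "\<lambda>j. gap x (a + j)" and N = "2 * W"])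
      show "gap x (a + 0) \<le> \<gamma>" using assms(1) by (simp add: chained_def)
      fix j assume "j < 2 * W"
      then show "gap x (a + Suc j) \<le> gap x (a + j) / 2 + e"
        using gap_Suc_le[OF assms(1) err[of "Suc (a + j)"]] n by simp
    qed (use assms that in auto)
    also have "\<gamma> / 2 ^ j \<le> \<gamma> / 2 ^ W"
      using \<gamma>_pos that by (intro divide_left_mono power_increasing) auto
    finally show ?thesis by (simp add: B_def)
  qed
  \<comment> \<open>\<open>z l\<close> is the image of \<open>p (n + l)\<close> at time \<open>n * m\<close>: it starts at \<open>q n\<close> and tends to the image
      of the forward limit\<close>
  define z where "z l = (inv f ^^ (l * m)) (q x (n + l))" for l
  have step: "dist (z (Suc l)) (z l) \<le> gap x (n + l) / 2 ^ Suc l" for l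
    using backward_step[OF assms(1), of l "n + l"] by (simp add: z_def)
  have "dist (z W) (z 0) \<le> B"
  proof (rule dist_le_of_geometric_steps)
    fix l assume "l < W"
    then have "gap x (n + l) \<le> B" using gap_le[of "Suc (W + l)"] n by (simp add: ac_simps)
    then have "gap x (n + l) / 2 ^ Suc l \<le> B / 2 ^ Suc l" by (intro divide_right_mono) auto
    with step show "dist (z (Suc l)) (z l) \<le> B / 2 ^ Suc l" by (rule order_trans)
  qed (rule B)
  moreover have tail: "dist (z (W + l)) (z W) \<le> \<gamma> / 2 ^ W" for l
  proof -
    have "dist (z (W + l)) (z (W + 0)) \<le> \<gamma> / 2 ^ W"
    proof (rule dist_le_of_geometric_steps[where z = "\<lambda>l. z (W + l)"])
      fix l
      have "gap x (n + (W + l)) / 2 ^ Suc (W + l) \<le> \<gamma> / 2 ^ Suc (W + l)"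
        using assms(1) by (intro divide_right_mono) (auto simp: chained_def)
      with step[of "W + l"] show "dist (z (W + Suc l)) (z (W + l)) \<le> \<gamma> / 2 ^ W / 2 ^ Suc l"
        by (simp add: power_add)
    qed (use \<gamma>_pos in simp)
    then show ?thesis by simp
  qed
  ultimately have bound: "dist (z 0) (z (W + l)) \<le> B + \<gamma> / 2 ^ W" for l
    by (metis add.commute add_mono dist_commute dist_triangle2 order_trans)
  have z_eq: "z l = (f ^^ (n * m)) (p x (l + n))" for l
  proof -
    have "(f ^^ (n * m)) (p x (l + n)) = (f ^^ (n * m)) ((inv f ^^ (n * m + l * m)) (q x (n + l)))"
      by (simp add: algebra_simps)
    then show ?thesis by (simp add: z_def funpow_add funpow_cancel_inv)
  qed
  have "(\<lambda>l. p x (l + n)) \<longlonglongrightarrow> Sh_plus f br m x"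
    using p_tendsto_Sh_plus[OF assms(1)] by (rule LIMSEQ_ignore_initial_segment)
  then have z_lim: "z \<longlonglongrightarrow> (f ^^ (n * m)) (Sh_plus f br m x)"
    unfolding z_eq[abs_def] by (rule continuous_on_tendsto_compose[OF continuous_funpow]) auto
  have "dist (z 0) ((f ^^ (n * m)) (Sh_plus f br m x)) \<le> B + \<gamma> / 2 ^ W"
  proof (rule Lim_dist_ubound[OF _ z_lim])
    show "\<forall>\<^sub>F l in sequentially. dist (z 0) (z l) \<le> B + \<gamma> / 2 ^ W"
      unfolding eventually_sequentially using bound by (metis le_Suc_ex)
  qed simp
  moreover have "dist (z 0) (x (int (n * m))) \<le> c * B"
  proof -
    have "gap x (a + W) \<le> B" by (rule gap_le) auto
    moreover have "dist (z 0) (x (int (n * m))) \<le> c * gap x (a + W)"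
    proof -
      have "gap x (a + W) \<le> \<gamma>" using assms(1) by (simp add: chained_def)
      then show ?thesis
        using bracket_forward[of "(f ^^ m) (q x (a + W))" "x (int (n * m))" 0]
        by (simp add: z_def n gap_def)
    qed
    ultimately show ?thesis using c_ge_1 by (meson mult_left_mono order_trans zero_le_one)
  qed
  ultimately have "dist ((f ^^ (n * m)) (Sh_plus f br m x)) (x (int (n * m)))
      \<le> (B + \<gamma> / 2 ^ W) + c * B"
    using dist_triangle3[of "(f ^^ (n * m)) (Sh_plus f br m x)" "x (int (n * m))" "z 0"] by simp
  then show ?thesis by (simp add: B_def[symmetric] distrib_right)
qed

text \<open>
  Passage from multiples of \<open>m\<close> to an arbitrary time \<open>i = n * m + r\<close> with \<open>r < m\<close>: the last \<open>r\<close> steps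
  cost a factor \<open>L ^ r \<le> L ^ m\<close>. Large \<open>i\<close> guarantees that the window does not reach below time \<open>0\<close>,
  where the forward construction starts.
\<close>
lemma Sh_plus_shadows_near_orbits:
  assumes "0 < \<epsilon>"
  obtains K J \<rho> where "0 < \<rho>"
    and "\<And>x i. chained x \<Longrightarrow> K \<le> i \<Longrightarrow> near_orbit f J \<rho> x (int i) \<Longrightarrow>
           dist ((f ^^ i) (Sh_plus f br m x)) (x (int i)) \<le> \<epsilon>"
proof -
  define A where "A = L ^ m"
  have A: "1 \<le> A" using L_ge_1 by (simp add: A_def)
  \<comment> \<open>the total error below is \<open>C / 2 ^ W + E * \<rho>\<close>; \<open>W\<close> and then \<open>\<rho>\<close> make each summand at most
      \<open>\<epsilon> / 2\<close>\<close>
  define C where "C = A * \<gamma> * (c + 2)"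
  have C: "0 < C" using A \<gamma>_pos c_ge_1 by (simp add: C_def)
  obtain W :: nat where "(1 / 2) ^ W < \<epsilon> / (2 * C)"
    using real_arch_pow_inv[of "\<epsilon> / (2 * C)" "1 / 2"] assms C by auto
  then have W: "C / 2 ^ W \<le> \<epsilon> / 2" using C by (simp add: field_simps power_one_over)
  define E where "E = 2 * A * (c + 1) * (A + 1) + A"
  have E: "0 < E"
  proof -
    have "0 \<le> 2 * A * (c + 1) * (A + 1)" using A c_ge_1 by (intro mult_nonneg_nonneg) auto
    then show ?thesis using A unfolding E_def by linarith
  qed
  define \<rho> where "\<rho> = \<epsilon> / (2 * E)"
  have \<rho>: "0 < \<rho>" "E * \<rho> = \<epsilon> / 2" using assms E by (auto simp: \<rho>_def)
  \<comment> \<open>\<open>W\<close> blocks on either side of block \<open>n\<close>, and one more because \<open>i\<close> lies up to \<open>m\<close> after \<open>n * m\<close>\<close>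
  define J where "J = (W + 1) * m"
  show thesis
  proof (rule that[of \<rho> J J])
    show "0 < \<rho>" by fact
    fix x i assume chained: "chained x" and i: "J \<le> i" and near: "near_orbit f J \<rho> x (int i)"
    define n where "n = i div m"
    define r where "r = i mod m"
    have i_eq: "i = n * m + r" by (simp add: n_def r_def)
    have r: "r < m" using m_pos by (simp add: r_def)
    have "W < n"
    proof -
      have "W + 1 \<le> n" unfolding n_def using i m_pos by (simp add: J_def less_eq_div_iff_mult_less_eq)
      then show ?thesis by simp
    qed
    \<comment> \<open>the true orbit that passes through \<open>x i\<close> at time \<open>i\<close>\<close>
    define y where "y j = int_iter f (int j - int i) (x (int i))" for j :: nat
    have orbit_step: "(f ^^ s) (y j) = y (j + s)" for j s
      using int_iter_add[OF bij, of "int s" "int j - int i" "x (int i)"]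
      by (simp add: y_def algebra_simps)
    have orbit_close: "dist (x (int j)) (y j) \<le> \<rho>" if "j \<le> i + J" "i \<le> j + J" for j
      using near[unfolded near_orbit_def, rule_format, of "int j - int i"] that
      by (simp add: y_def)
    have orbit_i: "y i = x (int i)" by (simp add: y_def)
    have "dist ((f ^^ (n * m)) (Sh_plus f br m x)) (x (int (n * m)))
           \<le> (c + 1) * (\<gamma> / 2 ^ W + 2 * ((A + 1) * \<rho>)) + \<gamma> / 2 ^ W"
    proof (rule Sh_plus_shadows_blocks[OF chained \<open>W < n\<close>])
      show "0 \<le> (A + 1) * \<rho>" using A \<rho> by simp
      fix k assume k: "n \<le> k + W" "k < n + W"
      have km: "n * m \<le> k * m + W * m" "k * m + m \<le> n * m + W * m"
        using mult_le_mono1[OF k(1), of m] mult_le_mono1[of "Suc k" "n + W" m] k(2)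
        by (simp_all add: algebra_simps)
      have close: "dist (x (int (k * m))) (y (k * m)) \<le> \<rho>"
        "dist (x (int (Suc k * m))) (y (Suc k * m)) \<le> \<rho>"
        by (rule orbit_close; use km r in \<open>simp add: J_def i_eq algebra_simps\<close>)+
      have "dist ((f ^^ m) (x (int (k * m)))) (x (int (Suc k * m)))
          \<le> dist ((f ^^ m) (x (int (k * m)))) ((f ^^ m) (y (k * m)))
            + dist (x (int (Suc k * m))) ((f ^^ m) (y (k * m)))"
        by (rule dist_triangle2)
      also have "\<dots> \<le> A * \<rho> + \<rho>"
      proof (rule add_mono)
        have "dist ((f ^^ m) (x (int (k * m)))) ((f ^^ m) (y (k * m)))
            \<le> A * dist (x (int (k * m))) (y (k * m))"
          unfolding A_def by (rule dist_funpow_lipschitz[OF lip])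
        also have "\<dots> \<le> A * \<rho>" using close(1) A by (intro mult_left_mono) auto
        finally show "dist ((f ^^ m) (x (int (k * m)))) ((f ^^ m) (y (k * m))) \<le> A * \<rho>" .
        show "dist (x (int (Suc k * m))) ((f ^^ m) (y (k * m))) \<le> \<rho>"
          using close(2) by (simp add: orbit_step add.commute)
      qed
      finally show "dist ((f ^^ m) (x (int (k * m)))) (x (int (Suc k * m))) \<le> (A + 1) * \<rho>"
        by (simp add: algebra_simps)
    qed
    moreover have "dist (x (int (n * m))) (y (n * m)) \<le> \<rho>"
      by (rule orbit_close) (use r in \<open>simp_all add: J_def i_eq\<close>)
    ultimately have total: "dist ((f ^^ (n * m)) (Sh_plus f br m x)) (y (n * m))
        \<le> (c + 1) * (\<gamma> / 2 ^ W + 2 * ((A + 1) * \<rho>)) + \<gamma> / 2 ^ W + \<rho>"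
      by (meson add_mono dist_triangle order_trans)
    have "dist ((f ^^ i) (Sh_plus f br m x)) (x (int i))
        = dist ((f ^^ r) ((f ^^ (n * m)) (Sh_plus f br m x))) ((f ^^ r) (y (n * m)))"
      by (simp only: orbit_step i_eq[symmetric] orbit_i)
         (simp add: i_eq add.commute[of _ r] funpow_add)
    also have "\<dots> \<le> L ^ r * dist ((f ^^ (n * m)) (Sh_plus f br m x)) (y (n * m))"
      by (rule dist_funpow_lipschitz[OF lip])
    also have "\<dots> \<le> A * ((c + 1) * (\<gamma> / 2 ^ W + 2 * ((A + 1) * \<rho>)) + \<gamma> / 2 ^ W + \<rho>)"
      using total L_ge_1 r A unfolding A_def
      by (intro mult_mono power_increasing) auto
    also have "\<dots> = C / 2 ^ W + E * \<rho>"
      by (simp add: C_def E_def algebra_simps add_divide_distrib)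
    also have "\<dots> \<le> \<epsilon>" using W \<rho> by linarith
    finally show "dist ((f ^^ i) (Sh_plus f br m x)) (x (int i)) \<le> \<epsilon>" .
  qed
qed

text \<open>
  The induced map brackets the backward limit \<open>a\<close> with the forward limit; at late times the forward
  contraction makes the influence of \<open>a\<close> negligible.
\<close>
lemma bracket_shadows_near_orbits:
  assumes "0 < \<epsilon>"
  obtains K J \<rho> where "0 < \<rho>"
    and "\<And>x i a. chained x \<Longrightarrow> dist a (Sh_plus f br m x) \<le> \<gamma> \<Longrightarrow> K \<le> i \<Longrightarrow>
           near_orbit f J \<rho> x (int i) \<Longrightarrow>
           dist ((f ^^ i) (br (a, Sh_plus f br m x))) (x (int i)) \<le> \<epsilon>"
proof -
  obtain K1 J \<rho> where \<rho>: "0 < \<rho>"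
    and *: "\<And>x i. chained x \<Longrightarrow> K1 \<le> i \<Longrightarrow> near_orbit f J \<rho> x (int i) \<Longrightarrow>
           dist ((f ^^ i) (Sh_plus f br m x)) (x (int i)) \<le> \<epsilon> / 2"
    using Sh_plus_shadows_near_orbits[of "\<epsilon> / 2"] assms by (metis half_gt_zero)
  obtain K2 where "lam ^ K2 < \<epsilon> / (2 * c * \<gamma>)"
    using real_arch_pow_inv[of "\<epsilon> / (2 * c * \<gamma>)" lam] assms c_ge_1 \<gamma>_pos lam_less_1 by auto
  then have K2: "c * lam ^ K2 * \<gamma> \<le> \<epsilon> / 2" using c_ge_1 \<gamma>_pos by (simp add: field_simps)
  show thesis
  proof (rule that[of \<rho> "max K1 K2" J])
    show "0 < \<rho>" by fact
    fix x i a assume x: "chained x" and a: "dist a (Sh_plus f br m x) \<le> \<gamma>"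
      and i: "max K1 K2 \<le> i" and near: "near_orbit f J \<rho> x (int i)"
    have "dist ((f ^^ i) (br (a, Sh_plus f br m x))) ((f ^^ i) (Sh_plus f br m x))
        \<le> c * lam ^ i * dist a (Sh_plus f br m x)"
      by (rule bracket_forward[OF a])
    also have "\<dots> \<le> c * lam ^ K2 * \<gamma>"
      using a i c_ge_1 lam_pos lam_less_1
      by (intro mult_mono power_decreasing mult_nonneg_nonneg) auto
    also have "\<dots> \<le> \<epsilon> / 2" by (rule K2)
    finally have "dist ((f ^^ i) (br (a, Sh_plus f br m x))) ((f ^^ i) (Sh_plus f br m x)) \<le> \<epsilon> / 2" .
    moreover have "dist ((f ^^ i) (Sh_plus f br m x)) (x (int i)) \<le> \<epsilon> / 2"
      using i near x by (intro *) auto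
    ultimately show "dist ((f ^^ i) (br (a, Sh_plus f br m x))) (x (int i)) \<le> \<epsilon>"
      using dist_triangle[of "(f ^^ i) (br (a, Sh_plus f br m x))" "x (int i)"
          "(f ^^ i) (Sh_plus f br m x)"] by simp
  qed
qed

end

section \<open>Self-tuning\<close>

lemma Sh_minus_eq_Sh_plus_reversed:
  assumes "bij f"
  shows "Sh_minus f br m x = Sh_plus (inv f) (br \<circ> prod.swap) m (\<lambda>i. x (- i))"
  by (simp add: Sh_minus_def Sh_plus_def shadow_pt_minus_def inv_inv_eq[OF assms])

text \<open>
  For a single time \<open>i\<close> shadowing is continuity alone: near the orbit of \<open>x i\<close> around time \<open>i\<close>, the
  sequence \<open>x\<close> agrees on a window around \<open>0\<close> with the orbit of \<open>f\<^sup>-\<^sup>i (x i)\<close>, which is sent to that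
  point. The window has to grow with \<open>\<bar>i\<bar>\<close>, so this serves only finitely many \<open>i\<close> at once.
\<close>
lemma fixed_time_shadows_near_orbits:
  fixes f :: "'a::metric_space \<Rightarrow> 'a"
  assumes "compact (UNIV :: 'a set)" and "bij f" and "continuous_on UNIV f" and "0 \<le> \<delta>"
    and "continuous_on UNIV (int_iter f i)"
    and Sh: "pseudo_orbit_map f \<delta> Sh" and "0 < \<epsilon>"
  obtains J \<rho> where "0 < \<rho>"
    and "\<And>x. x \<in> pseudo_orbits f \<delta> \<Longrightarrow> near_orbit f J \<rho> x i \<Longrightarrow>
           dist (int_iter f i (Sh x)) (x i) \<le> \<epsilon>"
proof -
  have "continuous_on (pseudo_orbits f \<delta>) (\<lambda>x. int_iter f i (Sh x))"
    using Sh by (intro continuous_on_compose2[OF assms(5)]) (auto simp: pseudo_orbit_map_def)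
  from continuous_uniform_on_window[OF compact_pseudo_orbits[OF assms(1,3)] this \<open>0 < \<epsilon>\<close>]
  obtain J \<rho> where \<rho>: "0 < \<rho>"
    and window: "\<And>x y. x \<in> pseudo_orbits f \<delta> \<Longrightarrow> y \<in> pseudo_orbits f \<delta> \<Longrightarrow>
           (\<And>j. \<bar>j\<bar> \<le> int J \<Longrightarrow> dist (x j) (y j) \<le> \<rho>) \<Longrightarrow>
           dist (int_iter f i (Sh x)) (int_iter f i (Sh y)) < \<epsilon>"
    by metis
  show thesis
  proof (rule that[of \<rho> "J + nat \<bar>i\<bar>"])
    show "0 < \<rho>" by fact
    fix x assume x: "x \<in> pseudo_orbits f \<delta>" and near: "near_orbit f (J + nat \<bar>i\<bar>) \<rho> x i"
    define a where "a = int_iter f (- i) (x i)"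
    have "dist (int_iter f i (Sh x)) (int_iter f i (Sh (orb f a))) < \<epsilon>"
    proof (rule window[OF x orb_in_pseudo_orbits[OF assms(2,4)]])
      fix j :: int assume "\<bar>j\<bar> \<le> int J"
      moreover have "orb f a j = int_iter f (j - i) (x i)"
        using int_iter_add[OF assms(2), of j "- i" "x i"] by (simp add: orb_def a_def)
      ultimately show "dist (x j) (orb f a j) \<le> \<rho>"
        using near[unfolded near_orbit_def, rule_format, of "j - i"] by simp
    qed
    moreover have "int_iter f i (Sh (orb f a)) = x i"
      using Sh int_iter_add[OF assms(2), of i "- i" "x i"]
      by (simp add: pseudo_orbit_map_def a_def)
    ultimately show "dist (int_iter f i (Sh x)) (x i) \<le> \<epsilon>" by simp
  qed
qed

theorem theorem5p14:
  fixes f :: "'a::metric_space \<Rightarrow> 'a"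
    and br :: "'a \<times> 'a \<Rightarrow> 'a"
    and \<mu> \<gamma> c lam L \<delta> :: real and m :: nat
  assumes "compact (UNIV :: 'a set)"
    and "0 < \<mu>" and "\<mu> < 1"
    and "homeomorphism UNIV UNIV f (inv f)"
    and "L-lipschitz_on UNIV f" and "L-lipschitz_on UNIV (inv f)"
    and "0 < \<gamma>" and "1 \<le> c" and "0 < lam" and "lam < 1"
    and "is_bracket \<gamma> br"
    and "hyperbolic_contraction f \<gamma> br c lam"
    and "1 \<le> m" and "c * lam ^ m \<le> 1 / (2 * c)"
    and "0 < \<delta>" and "2 * \<delta> * (\<Sum>j<m. L ^ j) \<le> \<gamma>"
    and "brackets_defined f \<gamma> br m \<delta>"
  shows "pseudo_orbit_map f \<delta> (induced_map f br m) \<and> self_tuning \<mu> f \<delta> (induced_map f br m)"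
proof
  have bij: "bij f"
    using assms(4) by (metis UNIV_I bijI' homeomorphism_def surjD rangeI)
  interpret fwd: hyperbolic_bracket f \<gamma> br c lam "max L 1" m
    by unfold_locales (use assms bij in \<open>auto intro: lipschitz_on_le\<close>)
  interpret bwd: hyperbolic_bracket "inv f" \<gamma> "br \<circ> prod.swap" c lam "max L 1" m
    by (rule fwd.reversed)
  let ?P = "pseudo_orbits f \<delta>" and ?Sh = "induced_map f br m"
  let ?rev = "\<lambda>(x :: int \<Rightarrow> 'a) i. x (- i)"
  note minus = Sh_minus_eq_Sh_plus_reversed[OF bij]
  have chained_fwd: "fwd.chained x" if "x \<in> ?P" for x
    using assms(17) that
    by (auto simp: brackets_defined_def near_diag_def fwd.chained_def fwd.gap_def)
  have chained_bwd: "bwd.chained (?rev x)" if "x \<in> ?P" for x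
    using assms(17) that
    by (auto simp: brackets_defined_def near_diag_def bwd.chained_def bwd.gap_def
        shadow_pt_minus_def dist_commute)
  have diag: "dist (Sh_minus f br m x) (Sh_plus f br m x) \<le> \<gamma>" if "x \<in> ?P" for x
    using assms(17) that by (auto simp: brackets_defined_def near_diag_def)

  show Sh: "pseudo_orbit_map f \<delta> ?Sh"
    unfolding pseudo_orbit_map_def
  proof (intro conjI allI)
    have "continuous_on ?P (\<lambda>x. Sh_plus (inv f) (br \<circ> prod.swap) m (?rev x))"
    proof (rule continuous_on_compose2[OF bwd.continuous_on_Sh_plus[of "?rev ` ?P"]])
      show "continuous_on ?P ?rev"
        by (intro continuous_on_coordinatewise_then_product
            continuous_on_subset[OF continuous_on_product_coordinates]) auto
    qed (use chained_bwd in auto)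
    then have "continuous_on ?P (\<lambda>x. (Sh_minus f br m x, Sh_plus f br m x))"
      unfolding minus
      by (intro continuous_on_Pair fwd.continuous_on_Sh_plus chained_fwd)
    then show "continuous_on ?P ?Sh"
      unfolding induced_map_def
      by (rule continuous_on_compose2[of "near_diag \<gamma>" br, rotated])
         (use diag assms(11) in \<open>auto simp: near_diag_def is_bracket_def\<close>)
    fix p
    have "?rev (orb f p) = orb (inv f) p"
      by (simp add: orb_def int_iter_inv[OF bij])
    then show "?Sh (orb f p) = p"
      using assms(11) by (simp add: induced_map_def minus fwd.Sh_plus_orb bwd.Sh_plus_orb is_bracket_def)
  qed

  have cont_iter: "continuous_on UNIV (int_iter f i)" for i
    by (cases i rule: int_cases2) (auto simp: fwd.continuous_funpow bwd.continuous_funpow)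

  show "self_tuning \<mu> f \<delta> ?Sh"
    unfolding self_tuning_def
  proof (intro allI impI)
    fix \<epsilon> :: real assume "0 < \<epsilon>"
    then have \<epsilon>: "0 < \<epsilon> / 2" by simp
    \<comment> \<open>the smallness requirements on \<open>\<eta>\<close> are collected as eventual properties as \<open>\<eta>\<close> tends to
        \<open>0\<close> from the right\<close>
    define close where "close \<eta> x i \<longleftrightarrow>
        x \<in> ?P \<and> seq_dist \<mu> (int_iter shift i x) (orb f (x i)) < \<eta>" for \<eta> x i
    have ev: "\<forall>\<^sub>F \<eta> in at_right 0. \<forall>x i. close \<eta> x i \<longrightarrow> near_orbit f J \<rho> x i" if "0 < \<rho>" for J \<rho>
    proof -
      have "0 < \<mu> ^ J * \<rho>" using assms(2) that by simp
      then have "\<forall>\<^sub>F \<eta> in at_right 0. \<eta> < \<mu> ^ J * \<rho>" by (rule order_tendstoD(2)[OF tendsto_ident_at])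
      then show ?thesis
      proof eventually_elim
        case (elim \<eta>)
        then show ?case
          using near_orbit_if_seq_dist_small[OF compact_imp_bounded[OF assms(1)] assms(2,3) that]
          by (meson close_def order.strict_trans)
      qed
    qed
    have fixed: "\<forall>\<^sub>F \<eta> in at_right 0. \<forall>x. close \<eta> x i \<longrightarrow> dist (int_iter f i (?Sh x)) (x i) \<le> \<epsilon> / 2" for i
    proof -
      obtain J \<rho> where "0 < \<rho>" and *: "\<And>x. x \<in> ?P \<Longrightarrow> near_orbit f J \<rho> x i \<Longrightarrow>
           dist (int_iter f i (?Sh x)) (x i) \<le> \<epsilon> / 2"
        using fixed_time_shadows_near_orbits[OF assms(1) bij fwd.continuous_f less_imp_le[OF assms(15)]
            cont_iter Sh \<epsilon>] by metis
      from ev[OF \<open>0 < \<rho>\<close>, of J] show ?thesis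
        by eventually_elim (use * in \<open>auto simp: close_def\<close>)
    qed
    obtain K1 J1 \<rho>1 where "0 < \<rho>1"
      and late: "\<And>x i a. fwd.chained x \<Longrightarrow> dist a (Sh_plus f br m x) \<le> \<gamma> \<Longrightarrow> K1 \<le> i \<Longrightarrow>
           near_orbit f J1 \<rho>1 x (int i) \<Longrightarrow>
           dist ((f ^^ i) (br (a, Sh_plus f br m x))) (x (int i)) \<le> \<epsilon> / 2"
      using fwd.bracket_shadows_near_orbits[OF \<epsilon>] by metis
    obtain K2 J2 \<rho>2 where "0 < \<rho>2"
      and early: "\<And>x i a. bwd.chained x \<Longrightarrow>
           dist a (Sh_plus (inv f) (br \<circ> prod.swap) m x) \<le> \<gamma> \<Longrightarrow> K2 \<le> i \<Longrightarrow>
           near_orbit (inv f) J2 \<rho>2 x (int i) \<Longrightarrow>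
           dist ((inv f ^^ i) ((br \<circ> prod.swap) (a, Sh_plus (inv f) (br \<circ> prod.swap) m x)))
             (x (int i)) \<le> \<epsilon> / 2"
      using bwd.bracket_shadows_near_orbits[OF \<epsilon>] by metis
    have "\<forall>\<^sub>F \<eta> in at_right 0. \<forall>i\<in>{- int K2..int K1}. \<forall>x. close \<eta> x i \<longrightarrow>
        dist (int_iter f i (?Sh x)) (x i) \<le> \<epsilon> / 2"
      by (intro eventually_ball_finite ballI fixed) auto
    with ev[OF \<open>0 < \<rho>1\<close>, of J1] ev[OF \<open>0 < \<rho>2\<close>, of J2] fixed[of 0] eventually_at_right_less[of 0]
    have "\<forall>\<^sub>F \<eta> in at_right 0. 0 < \<eta> \<and> (\<forall>x i. close \<eta> x i \<longrightarrow>
        dist (int_iter f i (?Sh x)) (?Sh (int_iter shift i x)) \<le> \<epsilon>)"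
    proof eventually_elim
      case (elim \<eta>)
      have "dist (int_iter f i (?Sh x)) (?Sh (int_iter shift i x)) \<le> \<epsilon>" if close: "close \<eta> x i" for x i
      proof -
        have x: "x \<in> ?P" using close by (simp add: close_def)
        have here: "dist (int_iter f i (?Sh x)) (x i) \<le> \<epsilon> / 2"
        proof -
          consider "i \<in> {- int K2..int K1}" | n where "i = int n" "K1 \<le> n"
            | n where "i = - int n" "K2 \<le> n"
            by (cases i rule: int_cases2) force+
          then show ?thesis
          proof cases
            case 1
            then show ?thesis using elim close by blast
          next
            case 2
            then show ?thesis
              using late[OF chained_fwd[OF x] diag[OF x], of n] elim(1) close
              by (simp add: induced_map_def)
          next
            case 3
            have "near_orbit (inv f) J2 \<rho>2 (?rev x) (int n)"
              using near_orbit_reverse[OF bij, of J2 \<rho>2 x i] elim(2) close 3 by simp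
            then show ?thesis
              using early[OF chained_bwd[OF x], of "Sh_plus f br m x" n] diag[OF x] 3
              by (simp add: induced_map_def minus dist_commute)
          qed
        qed
        \<comment> \<open>the shifted pseudo-orbit satisfies the same hypothesis at time \<open>0\<close>\<close>
        have "close \<eta> (int_iter shift i x) 0"
          using close shift_in_pseudo_orbits[of x f \<delta> i]
          by (simp add: close_def int_iter_shift)
        then have "dist (int_iter f 0 (?Sh (int_iter shift i x))) (int_iter shift i x 0) \<le> \<epsilon> / 2"
          using elim by blast
        then have "dist (?Sh (int_iter shift i x)) (x i) \<le> \<epsilon> / 2"
          by (simp add: int_iter_shift)
        with here show ?thesis
          using dist_triangle2[of "int_iter f i (?Sh x)" "?Sh (int_iter shift i x)" "x i"] by simp
      qed
      with elim show ?case by blast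
    qed
    then have "\<exists>\<eta>. 0 < \<eta> \<and> (\<forall>x i. close \<eta> x i \<longrightarrow>
        dist (int_iter f i (?Sh x)) (?Sh (int_iter shift i x)) \<le> \<epsilon>)"
      by (rule eventually_happens'[rotated]) simp
    then show "\<exists>\<eta>>0. \<forall>x\<in>?P. \<forall>i. seq_dist \<mu> (int_iter shift i x) (orb f (x i)) < \<eta> \<longrightarrow>
        dist (int_iter f i (?Sh x)) (?Sh (int_iter shift i x)) \<le> \<epsilon>"
      by (auto simp: close_def)
  qed
qed

end
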